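(* Let $H$ be an infinite dimensional complex Hilbert space and denote by $B(H)$ the ring of all bounded linear operators on $H$. If $p_1,p_2,p_3,p_4\in\mathbb{C}[X]$ are polynomials of degree $3$ and $B\in B(H)$, then there exist $B_1,B_2,B_3,B_4\in B(H)$ such that $$B=B_1+B_2+B_3+B_4 \quad\text{and}\quad p_i(B_i)=0 \text{ for all } i\in\{1,2,3,4\}.$$ *)

theory Defs
  imports "HOL-Analysis.Analysis" "HOL-Computational_Algebra.Polynomial"
begin

class complex_vector = real_vector +
  fixes scaleC :: "complex \<Rightarrow> 'a \<Rightarrow> 'a"  (infixr "*\<^sub>C" 75)
  assumes scaleC_add_right: "a *\<^sub>C (x + y) = a *\<^sub>C x + a *\<^sub>C y"
    and scaleC_add_left: "(a + b) *\<^sub>C x = a *\<^sub>C x + b *\<^sub>C x"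
    and scaleC_scaleC: "a *\<^sub>C (b *\<^sub>C x) = (a * b) *\<^sub>C x"
    and scaleC_one: "1 *\<^sub>C x = x"
    and scaleR_scaleC: "r *\<^sub>R x = complex_of_real r *\<^sub>C x"

global_interpretation complex_vector:
  vector_space "scaleC :: complex \<Rightarrow> 'a \<Rightarrow> 'a::complex_vector"
  by unfold_locales
    (simp_all add: scaleC_add_right scaleC_add_left scaleC_scaleC scaleC_one)

(* The inner product is linear in its first argument. Positive definiteness is not listed
   separately: it follows from cinner_self and the norm axioms of real_normed_vector. *)
class complex_inner = complex_vector + real_normed_vector +
  fixes cinner :: "'a \<Rightarrow> 'a \<Rightarrow> complex"
  assumes cinner_commute: "cinner x y = cnj (cinner y x)"
    and cinner_add_left: "cinner (x + y) z = cinner x z + cinner y z"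
    and cinner_scaleC_left: "cinner (a *\<^sub>C x) y = a * cinner x y"
    and cinner_self: "cinner x x = complex_of_real ((norm x)\<^sup>2)"

class complex_hilbert_space = complex_inner + complete_space

definition infinite_dimensional :: "'a::complex_vector itself \<Rightarrow> bool" where
  "infinite_dimensional _ \<longleftrightarrow>
     (\<nexists>S :: 'a set. finite S \<and> complex_vector.span S = UNIV)"

definition bounded_operators :: "('a::complex_hilbert_space \<Rightarrow> 'a) set"  ("\<B>") where
  "\<B> = {T. Vector_Spaces.linear scaleC scaleC T \<and> (\<exists>K. \<forall>x. norm (T x) \<le> K * norm x)}"

(* The ring operations of B(H) are pointwise addition and composition, so the i-th power
   of T is T ^^ i, with T ^^ 0 the identity operator. The library function poly only
   evaluates polynomials at elements of their (commutative) coefficient ring. *)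
definition poly_op :: "complex poly \<Rightarrow> ('a::complex_vector \<Rightarrow> 'a) \<Rightarrow> 'a \<Rightarrow> 'a" where
  "poly_op p T = (\<lambda>x. \<Sum>i\<le>degree p. coeff p i *\<^sub>C (T ^^ i) x)"

end

theory Submission
  imports Defs "HOL-Computational_Algebra.Fundamental_Theorem_Algebra"
begin

text \<open>
  An element is called cubic below if it is annihilated by a product of three linear factors
  with central roots. By the fundamental theorem of algebra the theorem asks for a decomposition
  of an arbitrary bounded operator into four cubic ones with prescribed roots, and everything
  except three analytic inputs takes place in the ring \<open>R\<close> of bounded operators.

  Since \<open>H\<close> is infinite dimensional, \<open>H \<cong> H \<oplus> H \<oplus> H\<close>, so elements of \<open>R\<close> are three by three
  matrices with entries in \<open>R\<close> (locale \<open>matrix_frame\<close>). A triangular matrix with the three roots on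
  its diagonal is cubic. An upper and a lower triangular one together realise every matrix whose
  diagonal consists of the right scalars, whatever its other entries are. Two cubic elements
  remain, and they only have to produce a prescribed diagonal \<open>(d1, d2, d3)\<close>.

  A conjugate of a lower bidiagonal matrix is cubic with diagonal \<open>(X, Y, s - X - Y)\<close> for
  arbitrary \<open>X\<close> and \<open>Y\<close>, where \<open>s\<close> is the sum of the roots. A trace obstruction is left over. It is
  removed by conjugating the last summand with a diagonal matrix of units, which twists two of its
  diagonal entries. The requirement becomes that \<open>d1 + d2 + d3\<close> minus a scalar be of the form
  \<open>(x - h x h') + (y - k y k')\<close> with units \<open>h, k\<close> whose inverses are \<open>h', k'\<close>
  (\<open>sum_of_four_cubics\<close>). For square matrices over a field this form would
  force the trace to vanish.

  In \<open>R\<close> every element \<open>E\<close> has this form (\<open>every_operator_is_sum_of_twists\<close>). Write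
  \<open>H = s1 H \<oplus> s2 H\<close> with isometries \<open>s1, s2\<close> and adjoints \<open>t1, t2\<close>. Then
  \<open>E = (t1 (s1 E) - (s1 E) t1) + s1 E t1\<close> is a commutator plus a copy of \<open>E\<close> in the corner \<open>s1 H\<close>.
  The ampliation \<open>P\<close>, which repeats \<open>E\<close> along \<open>s1 H, s2 s1 H, s2 s2 s1 H, ...\<close>, satisfies
  \<open>P = s1 E t1 + s2 P t2\<close>, so the corner copy is the commutator of \<open>P t2\<close> and \<open>s2\<close>. Finally
  \<open>a b - b a = x - b x b'\<close> for \<open>x = a b\<close> whenever \<open>b\<close> is a unit with inverse \<open>b'\<close>, and adding a
  scalar to \<open>b\<close> makes it a unit without changing the commutator.

  The analytic inputs are the decomposition of \<open>H\<close> (\<open>hilbert_space_is_double\<close>, by splitting an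
  orthonormal basis into two parts of the same cardinality), the existence of the ampliation as a
  strong limit (\<open>ampliation_exists\<close>) and the invertibility of \<open>2 - T\<close> for a contraction \<open>T\<close>
  (\<open>two_minus_contraction_invertible\<close>).
\<close>

section \<open>Sums of four cubic elements in a three by three matrix ring\<close>

text \<open>The sort \<open>{ring, monoid_mult}\<close> is used for unital rings in which \<open>0 = 1\<close> is possible. The bounded
operators on an arbitrary Hilbert space type form such a ring, because the space may be zero. For
the same reason the scalar two appears as \<open>1 + 1\<close> below.\<close>

definition central :: "'a::{ring,monoid_mult} \<Rightarrow> bool" where
  "central a \<longleftrightarrow> (\<forall>x. a * x = x * a)"

lemma centralD: "central a \<Longrightarrow> a * x = x * a"
  unfolding central_def by blast

lemma linear_factors_commute:
  assumes "central a" "central b"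
  shows "(T - a) * (T - b) = (T - b) * (T - a)"
proof -
  have "a * T = T * a" "b * T = T * b" "a * b = b * a"
    using assms by (blast intro: centralD)+
  then show ?thesis
    by (simp add: algebra_simps)
qed

lemma cubic_zero_conj:
  fixes C W W' :: "'a::{ring,monoid_mult}"
  assumes W: "W * W' = 1" "W' * W = 1"
    and cen: "central a" "central b" "central c"
    and C: "(C - a) * (C - b) * (C - c) = 0"
  shows "(W * C * W' - a) * (W * C * W' - b) * (W * C * W' - c) = 0"
proof -
  have conj: "W * C * W' - d = W * (C - d) * W'" if "central d" for d
  proof -
    have "W * d * W' = d * (W * W')"
      by (simp only: centralD[OF that, symmetric] mult.assoc)
    then show ?thesis
      by (simp add: W algebra_simps)
  qed
  have cancel: "W' * (W * z) = z" for z
    by (simp add: W(2) flip: mult.assoc)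
  have "(W * C * W' - a) * (W * C * W' - b) * (W * C * W' - c)
      = W * ((C - a) * (C - b) * (C - c)) * W'"
    unfolding conj[OF cen(1)] conj[OF cen(2)] conj[OF cen(3)] by (simp add: mult.assoc cancel)
  then show ?thesis
    by (simp add: C)
qed

text \<open>The matrix units of a three by three matrix ring in factored form: \<open>r i\<close> embeds the \<open>i\<close>-th
summand, \<open>q i\<close> projects to it, and \<open>q i * T * r j\<close> is the entry of \<open>T\<close> at \<open>(i, j)\<close>. The entries
lie in the ring itself, so the frame exhibits it as isomorphic to its own matrix ring.\<close>

locale matrix_frame =
  fixes r1 r2 r3 q1 q2 q3 :: "'a::{ring,monoid_mult}"
  assumes diag: "q1 * r1 = 1" "q2 * r2 = 1" "q3 * r3 = 1"
    and off_diag: "q1 * r2 = 0" "q1 * r3 = 0" "q2 * r1 = 0" "q2 * r3 = 0" "q3 * r1 = 0" "q3 * r2 = 0"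
    and sum_one: "r1 * q1 + r2 * q2 + r3 * q3 = 1"
begin

lemma cancel:
  "q1 * (r1 * z) = z" "q2 * (r2 * z) = z" "q3 * (r3 * z) = z"
  "q1 * (r2 * z) = 0" "q1 * (r3 * z) = 0" "q2 * (r1 * z) = 0"
  "q2 * (r3 * z) = 0" "q3 * (r1 * z) = 0" "q3 * (r2 * z) = 0"
  by (simp_all add: mult.assoc[symmetric] diag off_diag)

lemmas frame_simps = diag off_diag cancel ring_distribs mult.assoc

lemma zero_by_columns:
  assumes "T * r1 = 0" "T * r2 = 0" "T * r3 = 0"
  shows "T = 0"
proof -
  have "T = T * (r1 * q1 + r2 * q2 + r3 * q3)"
    by (simp add: sum_one)
  also have "\<dots> = 0"
    by (simp add: ring_distribs mult.assoc[symmetric] assms)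
  finally show ?thesis .
qed

lemma column_expand: "z = r1 * (q1 * z) + r2 * (q2 * z) + r3 * (q3 * z)"
proof -
  have "(r1 * q1 + r2 * q2 + r3 * q3) * z = z"
    by (simp add: sum_one)
  then show ?thesis
    by (simp add: distrib_right mult.assoc)
qed

text \<open>The factors \<open>T - c\<close>, \<open>T - b\<close>, \<open>T - a\<close> successively push everything down the flag
\<open>r1 \<subseteq> r1 + r2 \<subseteq> r1 + r2 + r3\<close> of invariant submodules.\<close>

lemma upper_triangular_cubic:
  assumes cen: "central a" "central b" "central c"
    and T1: "T * r1 = r1 * a"
    and T2: "T * r2 = r1 * m + r2 * b"
    and T3: "T * r3 = r1 * n + r2 * k + r3 * c"
  shows "(T - a) * (T - b) * (T - c) = 0"
proof (rule zero_by_columns)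
  note comm = linear_factors_commute[OF cen(1,2), of T] linear_factors_commute[OF cen(1,3), of T]
    linear_factors_commute[OF cen(2,3), of T]
  have c1: "(T - a) * r1 = 0"
    by (simp add: T1 centralD[OF cen(1), of r1] left_diff_distrib)
  have c2: "(T - b) * r2 = r1 * m"
    by (simp add: T2 centralD[OF cen(2), of r2] left_diff_distrib)
  have c3: "(T - c) * r3 = r1 * n + r2 * k"
    by (simp add: T3 centralD[OF cen(3), of r3] left_diff_distrib)
  have ab1: "(T - a) * (T - b) * r1 = 0"
    by (simp only: comm(1) mult.assoc c1 mult_zero_right)
  have ab2: "(T - a) * (T - b) * r2 = 0"
    by (simp add: mult.assoc c2) (simp add: mult.assoc[symmetric] c1)
  have last: "(T - a) * (T - b) * (T - c) = (T - c) * ((T - a) * (T - b))"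
    by (simp only: mult.assoc comm(3)) (simp only: mult.assoc[symmetric] comm(2))
  show "(T - a) * (T - b) * (T - c) * r1 = 0"
    by (simp only: last mult.assoc[of "T - c"] ab1 mult_zero_right)
  show "(T - a) * (T - b) * (T - c) * r2 = 0"
    by (simp only: last mult.assoc[of "T - c"] ab2 mult_zero_right)
  have "(T - a) * (T - b) * (T - c) * r3 = (T - a) * (T - b) * r1 * n + (T - a) * (T - b) * r2 * k"
    by (simp only: mult.assoc c3 distrib_left)
  then show "(T - a) * (T - b) * (T - c) * r3 = 0"
    by (simp add: ab1 ab2)
qed

lemma reversed: "matrix_frame r3 r2 r1 q3 q2 q1"
proof unfold_locales
  show "r3 * q3 + r2 * q2 + r1 * q1 = 1"
    using sum_one by (simp only: add_ac)
qed (simp_all add: diag off_diag)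

lemma lower_triangular_cubic:
  assumes cen: "central a" "central b" "central c"
    and T: "T * r1 = r3 * n + r2 * k + r1 * a" "T * r2 = r3 * m + r2 * b" "T * r3 = r3 * c"
  shows "(T - a) * (T - b) * (T - c) = 0"
proof -
  have "0 = (T - c) * (T - b) * (T - a)"
    using matrix_frame.upper_triangular_cubic[OF reversed cen(3,2,1) T(3,2,1)] by simp
  also have "(T - c) * (T - b) * (T - a) = (T - c) * ((T - a) * (T - b))"
    by (simp only: mult.assoc linear_factors_commute[OF cen(2,1)])
  also have "\<dots> = (T - a) * ((T - c) * (T - b))"
    by (simp only: mult.assoc[symmetric] linear_factors_commute[OF cen(3,1)])
  also have "\<dots> = (T - a) * (T - b) * (T - c)"
    by (simp only: mult.assoc linear_factors_commute[OF cen(3,2)])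
  finally show ?thesis by simp
qed

text \<open>Conjugating a lower bidiagonal matrix, with ones below the diagonal, by an upper unitriangular one
shifts the diagonal entries \<open>a, b, c\<close> by \<open>m\<close>, \<open>n - m\<close>, \<open>- n\<close>, where \<open>m\<close> and \<open>n\<close> are the two
superdiagonal entries and can be chosen freely.\<close>

lemma cubic_with_diagonal:
  assumes cen: "central a" "central b" "central c"
  obtains T where "(T - a) * (T - b) * (T - c) = 0"
    "q1 * T * r1 = X" "q2 * T * r2 = Y" "q3 * T * r3 = a + b + c - X - Y"
proof -
  define m where "m = X - a"
  define n where "n = Y - b + m"
  define C where "C = r1 * a * q1 + r2 * b * q2 + r3 * c * q3 + r2 * q1 + r3 * q2"
  define W where "W = 1 + r1 * m * q2 + r2 * n * q3"
  define W' where "W' = 1 - r1 * m * q2 - r2 * n * q3 + r1 * m * n * q3"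
  have inverse: "W * W' = 1" "W' * W = 1"
    by (simp_all add: W_def W'_def frame_simps)
  have C: "(C - a) * (C - b) * (C - c) = 0"
    by (rule lower_triangular_cubic[OF cen, where n = 0 and k = 1 and m = 1])
      (simp_all add: C_def frame_simps)
  have T: "(W * C * W' - a) * (W * C * W' - b) * (W * C * W' - c) = 0"
    by (rule cubic_zero_conj[OF inverse cen C])
  have X: "q1 * (W * C * W') * r1 = X"
    by (simp add: W_def W'_def C_def frame_simps) (simp add: m_def)
  have Y: "q2 * (W * C * W') * r2 = Y"
    by (simp add: W_def W'_def C_def frame_simps) (simp add: n_def)
  have Z: "q3 * (W * C * W') * r3 = a + b + c - X - Y"
    by (simp add: W_def W'_def C_def frame_simps) (simp add: m_def n_def algebra_simps)
  show ?thesis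
    by (rule that[OF T X Y Z])
qed

lemma cubic_with_twisted_diagonal:
  assumes cen: "central a" "central b" "central c"
    and G: "G * G' = 1" "G' * G = 1" and K: "K * K' = 1" "K' * K = 1"
  obtains T where "(T - a) * (T - b) * (T - c) = 0"
    "q1 * T * r1 = X" "q2 * T * r2 = G * Y * G'" "q3 * T * r3 = K * (a + b + c - X - Y) * K'"
proof -
  obtain S where S: "(S - a) * (S - b) * (S - c) = 0"
    "q1 * S * r1 = X" "q2 * S * r2 = Y" "q3 * S * r3 = a + b + c - X - Y"
    using cubic_with_diagonal[OF cen] by blast
  define W where "W = r1 * q1 + r2 * G * q2 + r3 * K * q3"
  define W' where "W' = r1 * q1 + r2 * G' * q2 + r3 * K' * q3"
  have inverse: "g * (g' * z) = z" if "g * g' = 1" for g g' z :: 'a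
    by (simp add: that flip: mult.assoc)
  have WW': "W * W' = 1" "W' * W = 1"
    using sum_one by (simp_all add: W_def W'_def frame_simps inverse G K)
  have "(W * S * W' - a) * (W * S * W' - b) * (W * S * W' - c) = 0"
    by (rule cubic_zero_conj[OF WW' cen S(1)])
  moreover have "q1 * (W * S * W') * r1 = q1 * S * r1" "q2 * (W * S * W') * r2 = G * (q2 * S * r2) * G'"
     "q3 * (W * S * W') * r3 = K * (q3 * S * r3) * K'"
    by (simp_all add: W_def W'_def frame_simps)
  ultimately show ?thesis
    by (intro that[of "W * S * W'"]) (simp_all only: S(2-4))
qed

text \<open>Triangular matrices are cubic, so it suffices to put the part of \<open>M\<close> above the diagonal into one
summand, the part below it into the other, and to share out the diagonal.\<close>

lemma two_cubics_with_scalar_diagonal: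
  assumes cen: "central a" "central b" "central c" "central a'" "central b'" "central c'"
    and M: "q1 * M * r1 = a + a'" "q2 * M * r2 = b + b'" "q3 * M * r3 = c + c'"
  obtains S T where "M = S + T" "(S - a) * (S - b) * (S - c) = 0" "(T - a') * (T - b') * (T - c') = 0"
proof -
  define S where "S = r1 * a * q1 + r2 * b * q2 + r3 * c * q3
    + r1 * (q1 * M * r2) * q2 + r1 * (q1 * M * r3) * q3 + r2 * (q2 * M * r3) * q3"
  define T where "T = M - S"
  have "(S - a) * (S - b) * (S - c) = 0"
    by (rule upper_triangular_cubic[OF cen(1-3), where m = "q1 * M * r2" and n = "q1 * M * r3" and k = "q2 * M * r3"])
      (simp_all add: S_def frame_simps)
  moreover have "(T - a') * (T - b') * (T - c') = 0"
  proof (rule lower_triangular_cubic[OF cen(4-6)])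
    note M' = M[unfolded mult.assoc]
    have S: "S * r1 = r1 * a" "S * r2 = r1 * (q1 * (M * r2)) + r2 * b"
      "S * r3 = r1 * (q1 * (M * r3)) + r2 * (q2 * (M * r3)) + r3 * c"
      by (simp_all add: S_def frame_simps)
    have T: "T * r = M * r - S * r" for r
      by (simp add: T_def left_diff_distrib)
    show "T * r1 = r3 * (q3 * (M * r1)) + r2 * (q2 * (M * r1)) + r1 * a'"
      by (subst T, subst column_expand[of "M * r1"]) (simp add: S M' algebra_simps)
    show "T * r2 = r3 * (q3 * (M * r2)) + r2 * b'"
      by (subst T, subst column_expand[of "M * r2"]) (simp add: S M' algebra_simps)
    show "T * r3 = r3 * c'"
      by (subst T, subst column_expand[of "M * r3"]) (simp add: S M' algebra_simps)
  qed
  ultimately show ?thesis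
    by (intro that[of S T]) (simp_all add: T_def)
qed

text \<open>The first two summands take care of everything off the diagonal. The third absorbs whatever the
fourth leaves in the first two diagonal entries. What remains is the third entry, and this is
exactly the equation that the hypothesis \<open>twists\<close> solves.\<close>

theorem sum_of_four_cubics:
  fixes B a1 b1 c1 a2 b2 c2 a3 b3 c3 a4 b4 c4 :: 'a
  assumes twists: "\<And>E :: 'a. \<exists>x y h h' k k'. h * h' = 1 \<and> h' * h = 1 \<and> k * k' = 1 \<and> k' * k = 1 \<and>
      E = (x - h * x * h') + (y - k * y * k')"
    and cen: "central a1" "central b1" "central c1" "central a2" "central b2" "central c2"
      "central a3" "central b3" "central c3" "central a4" "central b4" "central c4"
  obtains B1 B2 B3 B4 where "B = B1 + B2 + B3 + B4"
    "(B1 - a1) * (B1 - b1) * (B1 - c1) = 0" "(B2 - a2) * (B2 - b2) * (B2 - c2) = 0"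
    "(B3 - a3) * (B3 - b3) * (B3 - c3) = 0" "(B4 - a4) * (B4 - b4) * (B4 - c4) = 0"
proof -
  define d1 where "d1 = q1 * B * r1 - a1 - a2"
  define d2 where "d2 = q2 * B * r2 - b1 - b2"
  define d3 where "d3 = q3 * B * r3 - c1 - c2"
  define s3 where "s3 = a3 + b3 + c3"
  define s4 where "s4 = a4 + b4 + c4"
  obtain x y h h' k k' where hk: "h * h' = 1" "h' * h = 1" "k * k' = 1" "k' * k = 1"
    and E: "d1 + d2 + d3 - s3 - s4 = (x - h * x * h') + (y - k * y * k')"
    using twists[of "d1 + d2 + d3 - s3 - s4"] by blast
  have inverse: "g * (g' * z) = z" if "g * g' = 1" for g g' z :: 'a
    by (simp add: that flip: mult.assoc)
  obtain B3 where B3: "(B3 - a3) * (B3 - b3) * (B3 - c3) = 0"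
    "q1 * B3 * r1 = d1 - x" "q2 * B3 * r2 = d2 - y" "q3 * B3 * r3 = a3 + b3 + c3 - (d1 - x) - (d2 - y)"
    using cubic_with_diagonal[OF cen(7-9)] by blast
  \<comment> \<open>The twist \<open>k' h\<close> of the second entry is chosen so that the second entry becomes \<open>y\<close>,
     while the contribution of \<open>y\<close> to the third entry, twisted by \<open>h\<close>, becomes \<open>k y k'\<close>.\<close>
  have G: "(k' * h) * (h' * k) = 1" "(h' * k) * (k' * h) = 1"
    by (simp_all add: mult.assoc inverse hk)
  obtain B4 where B4: "(B4 - a4) * (B4 - b4) * (B4 - c4) = 0" "q1 * B4 * r1 = x"
    "q2 * B4 * r2 = k' * h * (h' * k * y * (k' * h)) * (h' * k)"
    "q3 * B4 * r3 = h * (a4 + b4 + c4 - x - h' * k * y * (k' * h)) * h'"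
    by (rule cubic_with_twisted_diagonal[OF cen(10-12) G hk(1,2), where X = x and Y = "h' * k * y * (k' * h)"])
  have B4_2: "q2 * B4 * r2 = y"
    unfolding B4(3) by (simp add: mult.assoc inverse hk)
  have s4: "central s4"
    unfolding s4_def central_def
    by (intro allI) (simp only: distrib_left distrib_right cen(10-12)[THEN centralD])
  have s4h: "h * s4 * h' = s4"
    unfolding centralD[OF s4, of h, symmetric] by (simp add: mult.assoc hk)
  have "h * (h' * k * y * (k' * h)) * h' = k * y * k'"
    by (simp add: mult.assoc inverse hk)
  then have B4_3: "q3 * B4 * r3 = s4 - h * x * h' - k * y * k'"
    unfolding B4(4) s4_def[symmetric] right_diff_distrib left_diff_distrib s4h by simp
  define M where "M = B - B3 - B4"
  have "q1 * M * r1 = a1 + a2" "q2 * M * r2 = b1 + b2"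
    by (simp_all add: M_def algebra_simps B3(2,3)[unfolded mult.assoc] B4(2)[unfolded mult.assoc]
        B4_2[unfolded mult.assoc] d1_def d2_def)
  moreover have "q3 * M * r3 = c1 + c2"
  proof -
    have "q3 * M * r3 = q3 * B * r3 - q3 * B3 * r3 - q3 * B4 * r3"
      by (simp add: M_def algebra_simps)
    also have "\<dots> = (d3 + c1 + c2) - (s3 - (d1 - x) - (d2 - y)) - (s4 - h * x * h' - k * y * k')"
      by (simp add: B3(4) B4_3 d3_def s3_def)
    also have "\<dots> = (d1 + d2 + d3 - s3 - s4) - ((x - h * x * h') + (y - k * y * k')) + c1 + c2"
      by (simp add: algebra_simps)
    also have "\<dots> = c1 + c2"
      by (simp add: E)
    finally show ?thesis .
  qed
  ultimately obtain B1 B2 where "M = B1 + B2" "(B1 - a1) * (B1 - b1) * (B1 - c1) = 0"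
    "(B2 - a2) * (B2 - b2) * (B2 - c2) = 0"
    by (rule two_cubics_with_scalar_diagonal[OF cen(1-6)])
  moreover from this have "B = B1 + B2 + B3 + B4"
    by (simp add: M_def algebra_simps)
  ultimately show ?thesis
    using that B3(1) B4(1) by blast
qed

end

text \<open>Here \<open>E\<close> is the sum of the commutators of \<open>t1\<close> with \<open>s1 * E\<close> and of \<open>P * t2\<close> with \<open>s2\<close>. The units
are \<open>2 - t1\<close> and \<open>2 - s2\<close>: they have the same commutators as \<open>t1\<close> and \<open>s2\<close> up to sign.\<close>

lemma twists_from_shifts:
  fixes s1 t1 s2 t2 :: "'a::{ring,monoid_mult}"
  assumes left_inverse: "t1 * s1 = 1" "t2 * s2 = 1"
    and inv: "(1 + 1 - t1) * h' = 1" "h' * (1 + 1 - t1) = 1" "(1 + 1 - s2) * k' = 1" "k' * (1 + 1 - s2) = 1"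
    and P: "P = s1 * E * t1 + s2 * P * t2"
  shows "\<exists>x y h h' k k'. h * h' = 1 \<and> h' * h = 1 \<and> k * k' = 1 \<and> k' * k = 1 \<and>
      E = (x - h * x * h') + (y - k * y * k')"
proof (intro exI conjI)
  let ?x = "s1 * E * (1 + 1 - t1)" and ?y = "- P * t2 * (1 + 1 - s2)"
  have "?x - (1 + 1 - t1) * ?x * h' = s1 * E * (1 + 1 - t1) - (1 + 1 - t1) * (s1 * E)"
    by (simp only: mult.assoc inv mult_1_right)
  also have "\<dots> = t1 * s1 * E - s1 * E * t1"
    by (simp add: algebra_simps)
  finally have first: "?x - (1 + 1 - t1) * ?x * h' = E - s1 * E * t1"
    by (simp add: left_inverse)
  have "?y - (1 + 1 - s2) * ?y * k' = (1 + 1 - s2) * (P * t2) - P * t2 * (1 + 1 - s2)"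
    using inv by (simp add: mult.assoc)
  also have "\<dots> = P * (t2 * s2) - s2 * P * t2"
    by (simp add: algebra_simps)
  also have "\<dots> = s1 * E * t1"
  proof -
    have "s1 * E * t1 = P - s2 * P * t2"
      by (subst P) simp
    then show ?thesis
      by (simp add: left_inverse)
  qed
  finally show "E = (?x - (1 + 1 - t1) * ?x * h') + (?y - (1 + 1 - s2) * ?y * k')"
    by (simp add: first)
qed (use inv in auto)

text \<open>Three summands arise from two by splitting the second one again.\<close>

lemma matrix_frame_from_halves:
  fixes s1 s2 t1 t2 :: "'a::{ring,monoid_mult}"
  assumes inv: "t1 * s1 = 1" "t2 * s2 = 1" "t1 * s2 = 0" "t2 * s1 = 0"
    and sum: "s1 * t1 + s2 * t2 = 1"
  shows "matrix_frame s1 (s2 * s1) (s2 * s2) t1 (t1 * t2) (t2 * t2)"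
proof
  have cancel: "t1 * (s1 * z) = z" "t2 * (s2 * z) = z" "t1 * (s2 * z) = 0" "t2 * (s1 * z) = 0" for z
    by (simp_all add: inv flip: mult.assoc)
  show "t1 * s1 = 1" "t1 * t2 * (s2 * s1) = 1" "t2 * t2 * (s2 * s2) = 1"
    "t1 * (s2 * s1) = 0" "t1 * (s2 * s2) = 0" "t1 * t2 * s1 = 0" "t1 * t2 * (s2 * s2) = 0"
    "t2 * t2 * s1 = 0" "t2 * t2 * (s2 * s1) = 0"
    by (simp_all add: mult.assoc cancel inv)
  have "s1 * t1 + s2 * s1 * (t1 * t2) + s2 * s2 * (t2 * t2) = s1 * t1 + s2 * (s1 * t1 + s2 * t2) * t2"
    by (simp add: distrib_left distrib_right mult.assoc add.assoc)
  then show "s1 * t1 + s2 * s1 * (t1 * t2) + s2 * s2 * (t2 * t2) = 1"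
    by (simp add: sum)
qed

section \<open>Inner products and finite orthonormal families\<close>

lemma cnj_cinner: "cnj (cinner x y) = cinner y x"
  by (rule cinner_commute[symmetric])

lemma cinner_zero_left [simp]: "cinner 0 y = 0"
  using cinner_add_left[of 0 0 y] by simp

lemma cinner_diff_left: "cinner (x - y) z = cinner x z - cinner y z"
  using cinner_add_left[of "x - y" y z] by simp

lemma cinner_add_right: "cinner x (y + z) = cinner x y + cinner x z"
  unfolding cinner_commute[of x "y + z"] by (simp add: cinner_add_left cnj_cinner)

lemma cinner_diff_right: "cinner x (y - z) = cinner x y - cinner x z"
  unfolding cinner_commute[of x "y - z"] by (simp add: cinner_diff_left cnj_cinner)

lemma cinner_zero_right [simp]: "cinner x 0 = 0"
  unfolding cinner_commute[of x 0] by simp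

lemma cinner_scaleC_right: "cinner x (a *\<^sub>C y) = cnj a * cinner x y"
  unfolding cinner_commute[of x "a *\<^sub>C y"] by (simp add: cinner_scaleC_left cnj_cinner)

lemma cinner_sum_left: "cinner (\<Sum>i\<in>F. f i) y = (\<Sum>i\<in>F. cinner (f i) y)"
  by (induction F rule: infinite_finite_induct) (simp_all add: cinner_add_left)

lemma cinner_sum_right: "cinner y (\<Sum>i\<in>F. f i) = (\<Sum>i\<in>F. cinner y (f i))"
  by (induction F rule: infinite_finite_induct) (simp_all add: cinner_add_right)

lemma norm_square_eq_cinner: "(norm x)\<^sup>2 = Re (cinner x x)"
  by (simp add: cinner_self)

lemma norm_scaleC [simp]: "norm (a *\<^sub>C x) = cmod a * norm (x :: 'a::complex_inner)"
proof -
  have "cinner (a *\<^sub>C x) (a *\<^sub>C x) = (a * cnj a) * cinner x x"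
    by (simp add: cinner_scaleC_left cinner_scaleC_right)
  also have "\<dots> = complex_of_real ((cmod a * norm x)\<^sup>2)"
    by (simp add: cinner_self power_mult_distrib flip: complex_norm_square)
  finally have "(norm (a *\<^sub>C x))\<^sup>2 = (cmod a * norm x)\<^sup>2"
    by (simp only: norm_square_eq_cinner Re_complex_of_real)
  then show ?thesis
    by (simp add: power2_eq_iff_nonneg)
qed

definition orthonormal :: "'i set \<Rightarrow> ('i \<Rightarrow> 'h::complex_inner) \<Rightarrow> bool" where
  "orthonormal A g \<longleftrightarrow> (\<forall>i\<in>A. \<forall>j\<in>A. cinner (g i) (g j) = (if i = j then 1 else 0))"

lemma orthonormal_subset: "orthonormal A g \<Longrightarrow> F \<subseteq> A \<Longrightarrow> orthonormal F g"
  unfolding orthonormal_def by blast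

lemma norm_square_orthonormal_sum:
  assumes "orthonormal F g" "finite F"
  shows "(norm (\<Sum>i\<in>F. c i *\<^sub>C g i))\<^sup>2 = (\<Sum>i\<in>F. (cmod (c i))\<^sup>2)"
proof -
  have "cinner (\<Sum>i\<in>F. c i *\<^sub>C g i) (\<Sum>i\<in>F. c i *\<^sub>C g i)
      = (\<Sum>i\<in>F. c i * (\<Sum>j\<in>F. cnj (c j) * cinner (g i) (g j)))"
    by (subst cinner_sum_left)
      (simp add: cinner_scaleC_left cinner_sum_right cinner_scaleC_right sum_distrib_left mult.left_commute)
  also have "\<dots> = (\<Sum>i\<in>F. c i * (\<Sum>j\<in>F. if i = j then cnj (c j) else 0))"
    using assms by (intro sum.cong refl arg_cong2[of _ _ _ _ "(*)"]) (auto simp: orthonormal_def)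
  also have "\<dots> = (\<Sum>i\<in>F. complex_of_real ((cmod (c i))\<^sup>2))"
    by (intro sum.cong refl) (simp add: assms(2) flip: complex_norm_square)
  also have "\<dots> = complex_of_real (\<Sum>i\<in>F. (cmod (c i))\<^sup>2)"
    by simp
  finally show ?thesis
    by (simp only: norm_square_eq_cinner Re_complex_of_real)
qed

lemma bessel_finite:
  assumes g: "orthonormal F g" and F: "finite F"
  shows "(\<Sum>i\<in>F. (cmod (cinner x (g i)))\<^sup>2) \<le> (norm x)\<^sup>2"
proof -
  define p where "p = (\<Sum>i\<in>F. cinner x (g i) *\<^sub>C g i)"
  let ?S = "\<Sum>i\<in>F. (cmod (cinner x (g i)))\<^sup>2"
  have xp: "cinner x p = of_real ?S"
    unfolding p_def cinner_sum_right cinner_scaleC_right of_real_sum complex_norm_square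
    by (simp add: mult.commute)
  have px: "cinner p x = of_real ?S"
    unfolding cinner_commute[of p x] xp by simp
  have pp: "(norm p)\<^sup>2 = ?S"
    unfolding p_def by (rule norm_square_orthonormal_sum[OF g F])
  have "(norm (x - p))\<^sup>2 = (norm x)\<^sup>2 - ?S"
    unfolding norm_square_eq_cinner[of "x - p"] cinner_diff_left cinner_diff_right xp px
    by (simp add: cinner_self pp)
  then show ?thesis
    using zero_le_power2[of "norm (x - p)"] by linarith
qed

text \<open>This is Bessel's inequality for the single vector \<open>y / norm y\<close>.\<close>

lemma cauchy_schwarz: "cmod (cinner x y) \<le> norm x * norm y"
proof (cases "y = 0")
  case False
  define e where "e = complex_of_real (inverse (norm y)) *\<^sub>C y"
  have "norm e = 1"
    using False by (simp add: e_def norm_inverse)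
  then have "orthonormal {()} (\<lambda>_. e)"
    by (simp add: orthonormal_def cinner_self)
  then have "(cmod (cinner x e))\<^sup>2 \<le> (norm x)\<^sup>2"
    using bessel_finite[of "{()}" "\<lambda>_. e" x] by simp
  then have "cmod (cinner x e) \<le> norm x"
    by (simp add: power2_le_iff_abs_le)
  moreover have "cmod (cinner x e) = cmod (cinner x y) / norm y"
    by (simp add: e_def cinner_scaleC_right norm_mult norm_inverse norm_divide divide_simps)
  ultimately show ?thesis
    using False by (simp add: divide_simps)
qed simp

lemma bounded_linear_cinner_left: "bounded_linear (\<lambda>x. cinner x y)"
  by (rule bounded_linear_intro[where K = "norm y"])
    (simp_all add: cinner_add_left scaleR_scaleC cinner_scaleC_left cauchy_schwarz scaleR_conv_of_real)

lemma bounded_linear_scaleC: "bounded_linear (\<lambda>x :: 'h::complex_inner. a *\<^sub>C x)"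
  by (rule bounded_linear_intro[where K = "cmod a"])
    (simp_all add: scaleC_add_right scaleR_scaleC scaleC_scaleC mult.commute)

section \<open>Orthonormal series and partial isometries\<close>

instance complex_hilbert_space \<subseteq> banach ..

text \<open>The Cauchy criterion for unconditional summability.\<close>

lemma summable_on_if_small_tails:
  fixes f :: "'i \<Rightarrow> 'b::banach"
  assumes tails: "\<And>e. e > 0 \<Longrightarrow> \<exists>F0. finite F0 \<and> F0 \<subseteq> A \<and>
      (\<forall>F. finite F \<longrightarrow> F \<subseteq> A - F0 \<longrightarrow> norm (sum f F) < e)"
  shows "f summable_on A"
proof -
  have "cauchy_filter (filtermap (sum f) (finite_subsets_at_top A))"
    unfolding cauchy_filter_metric_filtermap
  proof (intro allI impI)
    fix e :: real
    assume "e > 0"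
    then obtain F0 where F0: "finite F0" "F0 \<subseteq> A"
      and small: "\<And>F. finite F \<Longrightarrow> F \<subseteq> A - F0 \<Longrightarrow> norm (sum f F) < e / 2"
      using tails[of "e / 2"] by auto
    define P where "P F \<longleftrightarrow> finite F \<and> F0 \<subseteq> F \<and> F \<subseteq> A" for F
    have near: "dist (sum f F) (sum f F0) < e / 2" if "P F" for F
    proof -
      have "sum f F - sum f F0 = sum f (F - F0)"
        using that F0 by (simp add: P_def sum_diff)
      moreover have "norm (sum f (F - F0)) < e / 2"
        using that by (intro small) (auto simp: P_def)
      ultimately show ?thesis
        by (simp add: dist_norm)
    qed
    have "eventually P (finite_subsets_at_top A)"
      unfolding eventually_finite_subsets_at_top P_def using F0 by blast
    moreover have "dist (sum f F) (sum f F') < e" if "P F" "P F'" for F F'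
      using near[OF that(1)] near[OF that(2)] dist_triangle_half_l by blast
    ultimately show "\<exists>P. eventually P (finite_subsets_at_top A) \<and>
        (\<forall>x y. P x \<and> P y \<longrightarrow> dist (sum f x) (sum f y) < e)"
      by blast
  qed
  moreover have "complete (UNIV :: 'b set)"
    by (meson Cauchy_convergent UNIV_I complete_def convergent_def)
  ultimately obtain L where "(sum f \<longlongrightarrow> L) (finite_subsets_at_top A)"
    using complete_uniform[where S = "UNIV :: 'b set"] by (force simp add: filterlim_def)
  then show ?thesis
    using summable_on_def has_sum_def by blast
qed

lemma nonneg_summable_small_tails:
  fixes f :: "'i \<Rightarrow> real"
  assumes f: "f summable_on A" and nonneg: "\<And>i. i \<in> A \<Longrightarrow> f i \<ge> 0" and "e > 0"
  shows "\<exists>F0. finite F0 \<and> F0 \<subseteq> A \<and> (\<forall>F. finite F \<longrightarrow> F \<subseteq> A - F0 \<longrightarrow> sum f F < e)"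
proof -
  obtain F0 where F0: "finite F0" "F0 \<subseteq> A" "dist (sum f F0) (infsum f A) \<le> e / 2"
    using has_sum_finite_approximation[OF has_sum_infsum[OF f], of "e / 2"] \<open>e > 0\<close> by auto
  have "sum f F < e" if F: "finite F" "F \<subseteq> A - F0" for F
  proof -
    have "sum f F0 + sum f F = sum f (F0 \<union> F)"
      using F F0 by (subst sum.union_disjoint) auto
    also have "\<dots> \<le> infsum f A"
      using F F0 nonneg by (intro finite_sum_le_infsum f) auto
    finally show ?thesis
      using F0(3) \<open>e > 0\<close> unfolding dist_real_def by linarith
  qed
  then show ?thesis
    using F0 by blast
qed

text \<open>By Pythagoras the norm of a finite part of the series is controlled by the same part of the
square-summable coefficient family.\<close>

lemma orthonormal_series_summable:
  fixes g :: "'i \<Rightarrow> 'h::complex_hilbert_space"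
  assumes g: "orthonormal A g" and c: "(\<lambda>i. (cmod (c i))\<^sup>2) summable_on A"
  shows "(\<lambda>i. c i *\<^sub>C g i) summable_on A"
proof (rule summable_on_if_small_tails)
  fix e :: real
  assume "e > 0"
  then obtain F0 where F0: "finite F0" "F0 \<subseteq> A"
    and small: "\<And>F. finite F \<Longrightarrow> F \<subseteq> A - F0 \<Longrightarrow> (\<Sum>i\<in>F. (cmod (c i))\<^sup>2) < e\<^sup>2"
    using nonneg_summable_small_tails[OF c, of "e\<^sup>2"] by auto
  have "norm (\<Sum>i\<in>F. c i *\<^sub>C g i) < e" if F: "finite F" "F \<subseteq> A - F0" for F
  proof -
    have "orthonormal F g"
      using g by (rule orthonormal_subset) (use F in auto)
    then have "(norm (\<Sum>i\<in>F. c i *\<^sub>C g i))\<^sup>2 < e\<^sup>2"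
      using small[OF F] F by (simp add: norm_square_orthonormal_sum)
    then show ?thesis
      using \<open>e > 0\<close> by (simp add: power2_less_imp_less)
  qed
  then show "\<exists>F0. finite F0 \<and> F0 \<subseteq> A \<and>
      (\<forall>F. finite F \<longrightarrow> F \<subseteq> A - F0 \<longrightarrow> norm (\<Sum>i\<in>F. c i *\<^sub>C g i) < e)"
    using F0 by blast
qed

text \<open>The partial isometry that carries the orthonormal family \<open>g\<close> to \<open>h\<close> and vanishes on the orthogonal
complement of \<open>g\<close>. The families are indexed by \<open>A\<close>; for orthonormal families the unconditional sum
exists by Bessel's inequality.\<close>

definition basis_transfer :: "'i set \<Rightarrow> ('i \<Rightarrow> 'h) \<Rightarrow> ('i \<Rightarrow> 'h) \<Rightarrow> 'h \<Rightarrow> 'h::complex_hilbert_space" where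
  "basis_transfer A g h x = (\<Sum>\<^sub>\<infinity>i\<in>A. cinner x (g i) *\<^sub>C h i)"

lemma has_sum_basis_transfer:
  assumes g: "orthonormal A g" and h: "orthonormal A h"
  shows "((\<lambda>i. cinner x (g i) *\<^sub>C h i) has_sum basis_transfer A g h x) A"
proof -
  have "(\<lambda>i. (cmod (cinner x (g i)))\<^sup>2) summable_on A"
  proof (rule nonneg_bdd_above_summable_on)
    show "bdd_above (sum (\<lambda>i. (cmod (cinner x (g i)))\<^sup>2) ` {F. F \<subseteq> A \<and> finite F})"
      by (rule bdd_aboveI[where M = "(norm x)\<^sup>2"])
        (use bessel_finite orthonormal_subset[OF g] in blast)
  qed simp
  then show ?thesis
    unfolding basis_transfer_def by (intro has_sum_infsum orthonormal_series_summable h)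
qed

lemma norm_basis_transfer_le:
  assumes g: "orthonormal A g" and h: "orthonormal A h"
  shows "norm (basis_transfer A g h x) \<le> norm x"
proof -
  have "(sum (\<lambda>i. cinner x (g i) *\<^sub>C h i) \<longlongrightarrow> basis_transfer A g h x) (finite_subsets_at_top A)"
    using has_sum_basis_transfer[OF g h] by (simp add: has_sum_def)
  moreover have "norm (\<Sum>i\<in>F. cinner x (g i) *\<^sub>C h i) \<le> norm x" if F: "finite F" "F \<subseteq> A" for F
  proof -
    have "(norm (\<Sum>i\<in>F. cinner x (g i) *\<^sub>C h i))\<^sup>2 \<le> (norm x)\<^sup>2"
      using bessel_finite[OF orthonormal_subset[OF g]] norm_square_orthonormal_sum[OF orthonormal_subset[OF h]] F
      by simp
    then show ?thesis
      by (simp add: power2_le_iff_abs_le)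
  qed
  then have "\<forall>\<^sub>F F in finite_subsets_at_top A. norm (\<Sum>i\<in>F. cinner x (g i) *\<^sub>C h i) \<le> norm x"
    by (intro eventually_finite_subsets_at_top_weakI)
  ultimately show ?thesis
    by (intro Lim_norm_ubound[OF finite_subsets_at_top_neq_bot])
qed

lemma bounded_operators_iff:
  "T \<in> \<B> \<longleftrightarrow> (\<forall>x y. T (x + y) = T x + T y) \<and> (\<forall>a x. T (a *\<^sub>C x) = a *\<^sub>C T x) \<and>
     (\<exists>K. \<forall>x. norm (T x) \<le> K * norm x)"
  by (auto simp: bounded_operators_def Vector_Spaces.linear_iff complex_vector.vector_space_axioms)

lemma basis_transfer_bounded:
  assumes g: "orthonormal A g" and h: "orthonormal A h"
  shows "basis_transfer A g h \<in> \<B>"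
  unfolding bounded_operators_iff
proof (intro conjI allI exI)
  note sums = has_sum_basis_transfer[OF g h]
  show "basis_transfer A g h (x + y) = basis_transfer A g h x + basis_transfer A g h y" for x y
  proof (rule has_sum_unique[OF sums])
    show "((\<lambda>i. cinner (x + y) (g i) *\<^sub>C h i) has_sum basis_transfer A g h x + basis_transfer A g h y) A"
      using has_sum_add[OF sums sums] by (simp add: cinner_add_left scaleC_add_left)
  qed
  show "basis_transfer A g h (a *\<^sub>C x) = a *\<^sub>C basis_transfer A g h x" for a x
  proof (rule has_sum_unique[OF sums])
    show "((\<lambda>i. cinner (a *\<^sub>C x) (g i) *\<^sub>C h i) has_sum a *\<^sub>C basis_transfer A g h x) A"
      using has_sum_bounded_linear[OF bounded_linear_scaleC sums] by (simp add: cinner_scaleC_left scaleC_scaleC)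
  qed
  show "norm (basis_transfer A g h x) \<le> 1 * norm x" for x
    using norm_basis_transfer_le[OF g h] by simp
qed

text \<open>Transfers in opposite directions are adjoint, because both sides are the sum over \<open>i\<close> of
\<open>cinner x (g i) * cinner (h i) y\<close>.\<close>

lemma cinner_basis_transfer:
  assumes g: "orthonormal A g" and h: "orthonormal A h"
  shows "cinner (basis_transfer A g h x) y = cinner x (basis_transfer A h g y)"
proof (rule has_sum_unique)
  show "((\<lambda>i. cinner x (g i) * cinner (h i) y) has_sum cinner (basis_transfer A g h x) y) A"
    using has_sum_bounded_linear[OF bounded_linear_cinner_left has_sum_basis_transfer[OF g h]]
    by (simp add: cinner_scaleC_left)
  have "((\<lambda>i. cnj (cinner (cinner y (h i) *\<^sub>C g i) x)) has_sum cnj (cinner (basis_transfer A h g y) x)) A"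
    by (intro has_sum_bounded_linear[OF bounded_linear_cnj]
        has_sum_bounded_linear[OF bounded_linear_cinner_left has_sum_basis_transfer[OF h g]])
  then show "((\<lambda>i. cinner x (g i) * cinner (h i) y) has_sum cinner x (basis_transfer A h g y)) A"
    by (simp add: cinner_scaleC_left cnj_cinner mult.commute)
qed

lemma basis_transfer_coordinate:
  assumes g: "orthonormal A g" and h: "orthonormal A h" and j: "j \<in> A"
  shows "cinner (basis_transfer A g h x) (h j) = cinner x (g j)"
proof (rule has_sum_unique)
  show "((\<lambda>i. cinner x (g i) * cinner (h i) (h j)) has_sum cinner (basis_transfer A g h x) (h j)) A"
    using has_sum_bounded_linear[OF bounded_linear_cinner_left has_sum_basis_transfer[OF g h]]
    by (simp add: cinner_scaleC_left)
  show "((\<lambda>i. cinner x (g i) * cinner (h i) (h j)) has_sum cinner x (g j)) A"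
    by (rule has_sum_finite_neutralI[of "{j}"]) (use h j in \<open>auto simp: orthonormal_def\<close>)
qed

section \<open>Orthonormal bases\<close>

text \<open>Completeness of the family is expressed by a trivial orthogonal complement. This is what
maximality yields directly, and it suffices to compare vectors by their coordinates.\<close>

definition orthonormal_basis :: "'h::complex_inner set \<Rightarrow> bool" where
  "orthonormal_basis S \<longleftrightarrow> orthonormal S (\<lambda>e. e) \<and> (\<forall>y. (\<forall>e\<in>S. cinner y e = 0) \<longrightarrow> y = 0)"

text \<open>A maximal orthonormal set exists by Zorn's lemma. A nonzero vector orthogonal to it could be
normalised and added.\<close>

lemma orthonormal_basis_exists: "\<exists>S :: 'h::complex_inner set. orthonormal_basis S"
proof -
  let ?A = "{S :: 'h set. orthonormal S (\<lambda>e. e)}"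
  have "\<exists>M\<in>?A. \<forall>X\<in>?A. M \<subseteq> X \<longrightarrow> X = M"
  proof (rule subset_Zorn')
    fix C
    assume chain: "subset.chain ?A C"
    have "cinner d e = (if d = e then 1 else 0)" if de: "d \<in> \<Union>C" "e \<in> \<Union>C" for d e
    proof -
      obtain X Y where "X \<in> C" "Y \<in> C" "d \<in> X" "e \<in> Y"
        using de by blast
      moreover from this have "X \<subseteq> Y \<or> Y \<subseteq> X"
        using chain unfolding subset.chain_def by blast
      ultimately obtain Z where "Z \<in> C" "d \<in> Z" "e \<in> Z"
        by blast
      then show ?thesis
        using chain unfolding subset.chain_def orthonormal_def by blast
    qed
    then show "\<Union>C \<in> ?A"
      by (simp add: orthonormal_def)
  qed
  then obtain M :: "'h set" where M: "orthonormal M (\<lambda>e. e)"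
    and maximal: "\<And>X. orthonormal X (\<lambda>e. e) \<Longrightarrow> M \<subseteq> X \<Longrightarrow> X = M"
    by blast
  have "y = 0" if y: "\<forall>e\<in>M. cinner y e = 0" for y
  proof (rule ccontr)
    assume "y \<noteq> 0"
    define u where "u = complex_of_real (inverse (norm y)) *\<^sub>C y"
    have "norm u = 1"
      using \<open>y \<noteq> 0\<close> by (simp add: u_def norm_inverse)
    then have uu: "cinner u u = 1"
      by (simp add: cinner_self)
    have ue: "cinner u e = 0" "cinner e u = 0" if "e \<in> M" for e
      using y that cinner_commute[of e y] by (simp_all add: u_def cinner_scaleC_left cinner_scaleC_right)
    have "u \<notin> M"
      using uu ue by force
    moreover have "orthonormal (insert u M) (\<lambda>e. e)"
      using M uu ue \<open>u \<notin> M\<close> by (auto simp: orthonormal_def)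
    ultimately show False
      using maximal[of "insert u M"] by blast
  qed
  with M show ?thesis
    unfolding orthonormal_basis_def by blast
qed

text \<open>Over a finite basis every vector would equal its finite Fourier expansion.\<close>

lemma orthonormal_basis_infinite:
  fixes S :: "'h::complex_inner set"
  assumes inf: "infinite_dimensional TYPE('h)" and S: "orthonormal_basis S"
  shows "infinite S"
proof
  assume fin: "finite S"
  have "x \<in> complex_vector.span S" for x
  proof -
    define p where "p = (\<Sum>e\<in>S. cinner x e *\<^sub>C e)"
    have "cinner (x - p) d = 0" if d: "d \<in> S" for d
    proof -
      have "cinner p d = (\<Sum>e\<in>S. cinner x e * cinner e d)"
        by (simp add: p_def cinner_sum_left cinner_scaleC_left)
      also have "\<dots> = (\<Sum>e\<in>S. if e = d then cinner x e else 0)"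
        using S d by (intro sum.cong refl) (simp add: orthonormal_basis_def orthonormal_def)
      also have "\<dots> = cinner x d"
        using d fin by simp
      finally show ?thesis
        by (simp add: cinner_diff_left)
    qed
    then have "x - p = 0"
      using S unfolding orthonormal_basis_def by blast
    then have "x = p"
      by simp
    also have "p \<in> complex_vector.span S"
      unfolding p_def
      by (intro complex_vector.span_sum complex_vector.span_scale complex_vector.span_base)
    finally show ?thesis .
  qed
  then have "complex_vector.span S = UNIV"
    by blast
  with fin inf show False
    unfolding infinite_dimensional_def by blast
qed

text \<open>An infinite set is equipotent to the disjoint sum of two copies of itself.\<close>

lemma infinite_set_splits:
  assumes "infinite S"
  obtains f1 f2 where "inj_on f1 S" "inj_on f2 S" "f1 ` S \<inter> f2 ` S = {}" "f1 ` S \<union> f2 ` S = S"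
proof -
  have "(card_of (S <+> S), card_of S) \<in> ordIso"
    using assms card_of_Plus_infinite1 card_of_mono1 by blast
  then obtain f where f: "bij_betw f (S <+> S) S"
    using card_of_ordIso by blast
  show ?thesis
  proof (rule that[of "f \<circ> Inl" "f \<circ> Inr"])
    have inj: "inj_on f (S <+> S)" and img: "f ` (S <+> S) = S"
      using f by (simp_all add: bij_betw_def)
    show "inj_on (f \<circ> Inl) S" "inj_on (f \<circ> Inr) S"
      by (intro comp_inj_on; force intro: inj_on_subset[OF inj] inj_onI)+
    show "(f \<circ> Inl) ` S \<inter> (f \<circ> Inr) ` S = {}"
      using inj by (force simp: inj_on_def)
    show "(f \<circ> Inl) ` S \<union> (f \<circ> Inr) ` S = S"
      using img unfolding Plus_def by (simp add: image_Un image_comp)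
  qed
qed

section \<open>The ring of bounded operators\<close>

lemma bounded_operator_rules:
  assumes "T \<in> \<B>"
  shows "T (x + y) = T x + T y" "T (a *\<^sub>C x) = a *\<^sub>C T x" "T (x - y) = T x - T y" "T 0 = 0"
    and "bounded_linear T"
proof -
  show add: "T (x + y) = T x + T y" for x y
    using assms by (simp add: bounded_operators_iff)
  show scale: "T (a *\<^sub>C x) = a *\<^sub>C T x" for a x
    using assms by (simp add: bounded_operators_iff)
  show "T (x - y) = T x - T y"
    using add[of "x - y" y] by (simp add: algebra_simps)
  show "T 0 = 0"
    using add[of 0 0] by simp
  obtain K where "\<And>x. norm (T x) \<le> K * norm x"
    using assms by (auto simp: bounded_operators_iff)
  then show "bounded_linear T"
    by (intro bounded_linear_intro[where K = K]) (simp_all add: add scaleR_scaleC scale mult.commute)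
qed

lemma bounded_operators_norm_bound:
  assumes "T \<in> \<B>"
  obtains K where "K \<ge> 0" "\<And>x. norm (T x) \<le> K * norm x"
proof -
  obtain K where "K > 0" "\<And>x. norm (T x) \<le> norm x * K"
    using bounded_linear.pos_bounded[OF bounded_operator_rules(5)[OF assms]] by blast
  then show ?thesis
    by (intro that[of K]) (simp_all add: mult.commute)
qed

lemma bounded_operators_add:
  assumes "S \<in> \<B>" "T \<in> \<B>"
  shows "(\<lambda>x. S x + T x) \<in> \<B>"
proof -
  obtain K L where "\<And>x. norm (S x) \<le> K * norm x" "\<And>x. norm (T x) \<le> L * norm x"
    using assms[THEN bounded_operators_norm_bound] by metis
  then have "norm (S x + T x) \<le> (K + L) * norm x" for x
    by (intro norm_triangle_le) (simp add: distrib_right add_mono)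
  then show ?thesis
    unfolding bounded_operators_iff using assms
    by (auto simp: bounded_operator_rules scaleC_add_right)
qed

lemma bounded_operators_compose:
  assumes "S \<in> \<B>" "T \<in> \<B>"
  shows "(\<lambda>x. S (T x)) \<in> \<B>"
proof -
  obtain K where K: "K \<ge> 0" "\<And>x. norm (S x) \<le> K * norm x"
    using bounded_operators_norm_bound[OF assms(1)] by blast
  obtain L where L: "\<And>x. norm (T x) \<le> L * norm x"
    using bounded_operators_norm_bound[OF assms(2)] by blast
  have "norm (S (T x)) \<le> (K * L) * norm x" for x
    using order_trans[OF K(2)[of "T x"] mult_left_mono[OF L[of x] K(1)]] by (simp add: mult.assoc)
  then show ?thesis
    unfolding bounded_operators_iff using assms
    by (auto simp: bounded_operator_rules)
qed

lemma bounded_operators_scalar: "(\<lambda>x. a *\<^sub>C x) \<in> \<B>"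
  unfolding bounded_operators_iff
  by (auto simp: scaleC_add_right scaleC_scaleC mult.commute intro: exI[of _ "cmod a"])

typedef (overloaded) 'h operator = "\<B> :: ('h::complex_hilbert_space \<Rightarrow> 'h) set"
  morphisms apply_operator Operator
proof
  show "(\<lambda>x. 0) \<in> \<B>"
    by (auto simp: bounded_operators_iff intro: exI[of _ 0])
qed

setup_lifting type_definition_operator

lemmas apply_operator_rules = bounded_operator_rules[OF apply_operator]

instantiation operator :: (complex_hilbert_space) "{ring, monoid_mult}"
begin

lift_definition zero_operator :: "'a operator" is "\<lambda>x. 0"
  by (auto simp: bounded_operators_iff intro: exI[of _ 0])

lift_definition one_operator :: "'a operator" is "\<lambda>x. x"
  by (auto simp: bounded_operators_iff intro: exI[of _ 1])

lift_definition plus_operator :: "'a operator \<Rightarrow> 'a operator \<Rightarrow> 'a operator" is "\<lambda>S T x. S x + T x"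
  by (rule bounded_operators_add)

lift_definition uminus_operator :: "'a operator \<Rightarrow> 'a operator" is "\<lambda>T x. (- 1) *\<^sub>C T x"
  by (rule bounded_operators_compose[OF bounded_operators_scalar])

lift_definition minus_operator :: "'a operator \<Rightarrow> 'a operator \<Rightarrow> 'a operator"
  is "\<lambda>S T x. S x + (- 1) *\<^sub>C T x"
  by (intro bounded_operators_add bounded_operators_compose[OF bounded_operators_scalar])

lift_definition times_operator :: "'a operator \<Rightarrow> 'a operator \<Rightarrow> 'a operator" is "\<lambda>S T x. S (T x)"
  by (rule bounded_operators_compose)

instance
proof
  fix a b c :: "'a operator"
  show "a + b + c = a + (b + c)" "a + b = b + a" "0 + a = a"
    by (transfer, simp add: add_ac)+
  show "- a + a = 0"
    by transfer (simp add: complex_vector.scale_minus_left scaleC_one)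
  show "a - b = a + - b"
    by transfer simp
  show "a * b * c = a * (b * c)" "1 * a = a" "a * 1 = a" "(a + b) * c = a * c + b * c"
    by (transfer, simp)+
  show "a * (b + c) = a * b + a * c"
    by transfer (simp add: bounded_operator_rules)
qed

end

lift_definition scalar_operator :: "complex \<Rightarrow> 'h::complex_hilbert_space operator" is "\<lambda>a x. a *\<^sub>C x"
  by (rule bounded_operators_scalar)

lemma scalar_operator_central: "central (scalar_operator a)"
  unfolding central_def by transfer (simp add: bounded_operator_rules)

lemma apply_simps:
  "apply_operator 0 x = 0" "apply_operator 1 x = x"
  "apply_operator (S + T) x = apply_operator S x + apply_operator T x"
  "apply_operator (S - T) x = apply_operator S x - apply_operator T x"
  "apply_operator (S * T) x = apply_operator S (apply_operator T x)"
  "apply_operator (scalar_operator a) x = a *\<^sub>C x"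
  by (transfer, simp add: complex_vector.scale_minus_left scaleC_one)+

lemma operator_eqI: "(\<And>x. apply_operator S x = apply_operator T x) \<Longrightarrow> S = T"
  by (simp add: apply_operator_inject[symmetric] fun_eq_iff)

section \<open>An infinite dimensional Hilbert space is twice itself\<close>

text \<open>A basis \<open>S\<close> splits into the images of two injections \<open>f1, f2\<close> of \<open>S\<close>. The isometry \<open>s i\<close> maps the
basis along \<open>f i\<close>, and \<open>t i\<close> is its adjoint. All identities between these maps are checked on
coordinates.\<close>

lemma hilbert_space_is_double:
  assumes "infinite_dimensional TYPE('h::complex_hilbert_space)"
  obtains s1 s2 t1 t2 :: "'h::complex_hilbert_space \<Rightarrow> 'h" where
    "s1 \<in> \<B>" "s2 \<in> \<B>" "t1 \<in> \<B>" "t2 \<in> \<B>"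
    "\<And>x. t1 (s1 x) = x" "\<And>x. t2 (s2 x) = x" "\<And>x. t1 (s2 x) = 0" "\<And>x. t2 (s1 x) = 0"
    "\<And>x. s1 (t1 x) + s2 (t2 x) = x" "\<And>x. (norm x)\<^sup>2 = (norm (t1 x))\<^sup>2 + (norm (t2 x))\<^sup>2"
proof -
  obtain S :: "'h set" where S: "orthonormal_basis S"
    using orthonormal_basis_exists by blast
  then have id: "orthonormal S (\<lambda>e. e)" and total: "\<And>y. (\<And>e. e \<in> S \<Longrightarrow> cinner y e = 0) \<Longrightarrow> y = 0"
    unfolding orthonormal_basis_def by blast+
  have ext: "x = y" if "\<And>e. e \<in> S \<Longrightarrow> cinner x e = cinner y e" for x y
    using total[of "x - y"] that by (simp add: cinner_diff_left)
  obtain f1 f2 where inj: "inj_on f1 S" "inj_on f2 S"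
    and disj: "f1 ` S \<inter> f2 ` S = {}" and cover: "f1 ` S \<union> f2 ` S = S"
    using infinite_set_splits[OF orthonormal_basis_infinite[OF assms S]] by blast
  have f: "orthonormal S f" if "inj_on f S" "f ` S \<subseteq> S" for f
    unfolding orthonormal_def
  proof (intro ballI)
    fix d e
    assume de: "d \<in> S" "e \<in> S"
    have "f d \<in> S" "f e \<in> S" "f d = f e \<longleftrightarrow> d = e"
      using that de by (auto dest: inj_onD)
    then show "cinner (f d) (f e) = (if d = e then 1 else 0)"
      using id by (simp add: orthonormal_def)
  qed
  have f1: "orthonormal S f1" and f2: "orthonormal S f2"
    using f inj cover by blast+
  have f12: "cinner (f1 d) (f2 e) = 0" "cinner (f2 e) (f1 d) = 0" if "d \<in> S" "e \<in> S" for d e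
  proof -
    have "f1 d \<in> S" "f2 e \<in> S" "f1 d \<noteq> f2 e"
      using that cover disj by blast+
    then show "cinner (f1 d) (f2 e) = 0" "cinner (f2 e) (f1 d) = 0"
      using id unfolding orthonormal_def by auto
  qed
  define s1 where "s1 = basis_transfer S (\<lambda>e. e) f1"
  define s2 where "s2 = basis_transfer S (\<lambda>e. e) f2"
  define t1 where "t1 = basis_transfer S f1 (\<lambda>e. e)"
  define t2 where "t2 = basis_transfer S f2 (\<lambda>e. e)"
  have adjoint: "cinner (s1 x) y = cinner x (t1 y)" "cinner (s2 x) y = cinner x (t2 y)" for x y
    unfolding s1_def s2_def t1_def t2_def by (intro cinner_basis_transfer id f1 f2)+
  have t_coord: "cinner (t1 x) e = cinner x (f1 e)" "cinner (t2 x) e = cinner x (f2 e)" if "e \<in> S" for x e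
    unfolding t1_def t2_def by (intro basis_transfer_coordinate id f1 f2 that)+
  have s_coord: "cinner (s1 x) (f1 e) = cinner x e" "cinner (s2 x) (f2 e) = cinner x e" if "e \<in> S" for x e
    unfolding s1_def s2_def by (intro basis_transfer_coordinate id f1 f2 that)+
  have "t1 (f2 e) = 0" if "e \<in> S" for e
    by (rule total) (simp add: t_coord f12 that)
  moreover have "t2 (f1 e) = 0" if "e \<in> S" for e
    by (rule total) (simp add: t_coord f12 that)
  ultimately have s_cross: "cinner (s1 x) (f2 e) = 0" "cinner (s2 x) (f1 e) = 0" if "e \<in> S" for x e
    using that by (simp_all add: adjoint)
  have decomp: "s1 (t1 x) + s2 (t2 x) = x" for x
  proof (rule ext)
    fix e
    assume "e \<in> S"
    then obtain d where "d \<in> S" "e = f1 d \<or> e = f2 d"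
      using cover by blast
    then show "cinner (s1 (t1 x) + s2 (t2 x)) e = cinner x e"
      by (auto simp: cinner_add_left s_coord s_cross t_coord)
  qed
  have norms: "(norm x)\<^sup>2 = (norm (t1 x))\<^sup>2 + (norm (t2 x))\<^sup>2" for x
  proof -
    have "cinner x x = cinner (s1 (t1 x) + s2 (t2 x)) x"
      by (simp only: decomp)
    also have "\<dots> = cinner (t1 x) (t1 x) + cinner (t2 x) (t2 x)"
      by (simp only: cinner_add_left adjoint)
    finally have "complex_of_real ((norm x)\<^sup>2) = complex_of_real ((norm (t1 x))\<^sup>2 + (norm (t2 x))\<^sup>2)"
      unfolding of_real_add by (simp only: cinner_self)
    then show ?thesis
      by (simp only: of_real_eq_iff)
  qed
  show ?thesis
  proof (rule that[of s1 s2 t1 t2])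
    show "s1 \<in> \<B>" "s2 \<in> \<B>" "t1 \<in> \<B>" "t2 \<in> \<B>"
      unfolding s1_def s2_def t1_def t2_def by (intro basis_transfer_bounded id f1 f2)+
    show "t1 (s1 x) = x" "t2 (s2 x) = x" "t1 (s2 x) = 0" "t2 (s1 x) = 0" for x
      by (rule ext, simp add: t_coord s_coord s_cross)+
  qed (fact decomp norms)+
qed

section \<open>Ampliations and inverses\<close>

text \<open>The operator that repeats \<open>E\<close> on the first \<open>n\<close> of the orthogonal summands \<open>s1 H\<close>, \<open>s2 s1 H\<close>,
\<open>s2 s2 s1 H\<close>, and so on, and vanishes on the rest.\<close>

primrec truncated_ampliation ::
  "('h \<Rightarrow> 'h) \<Rightarrow> ('h \<Rightarrow> 'h) \<Rightarrow> ('h \<Rightarrow> 'h) \<Rightarrow> ('h \<Rightarrow> 'h) \<Rightarrow> ('h \<Rightarrow> 'h) \<Rightarrow> nat \<Rightarrow> 'h \<Rightarrow> 'h::real_vector" where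
  "truncated_ampliation s1 s2 t1 t2 E 0 = (\<lambda>x. 0)"
| "truncated_ampliation s1 s2 t1 t2 E (Suc n) =
    (\<lambda>x. s1 (E (t1 x)) + s2 (truncated_ampliation s1 s2 t1 t2 E n (t2 x)))"

text \<open>The truncations converge pointwise, though in general not in norm: by orthogonality the squared norm
of the difference of two of them at \<open>x\<close> is at most a constant times the drop of \<open>(norm ((t2 ^^ n) x))\<^sup>2\<close> between the two indices, and this sequence
decreases in \<open>n\<close>.\<close>

lemma ampliation_exists:
  fixes s1 s2 t1 t2 E :: "'h::complex_hilbert_space \<Rightarrow> 'h"
  assumes B: "s1 \<in> \<B>" "s2 \<in> \<B>" "t1 \<in> \<B>" "t2 \<in> \<B>" "E \<in> \<B>"
    and inv: "\<And>x. t1 (s1 x) = x" "\<And>x. t2 (s2 x) = x" "\<And>x. t1 (s2 x) = 0" "\<And>x. t2 (s1 x) = 0"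
    and norms: "\<And>x. (norm x)\<^sup>2 = (norm (t1 x))\<^sup>2 + (norm (t2 x))\<^sup>2"
  obtains P where "P \<in> \<B>" "\<And>x. P x = s1 (E (t1 x)) + s2 (P (t2 x))"
proof -
  define X where "X = truncated_ampliation s1 s2 t1 t2 E"
  have X0: "X 0 x = 0" and X_Suc: "X (Suc n) x = s1 (E (t1 x)) + s2 (X n (t2 x))" for n x
    by (simp_all add: X_def)
  note rules = B[THEN bounded_operator_rules(1)] B[THEN bounded_operator_rules(2)]
    B[THEN bounded_operator_rules(3)] B[THEN bounded_operator_rules(4)]
  obtain K where K: "K > 0" "\<And>x. norm (E x) \<le> norm x * K"
    using bounded_linear.pos_bounded[OF bounded_operator_rules(5)[OF B(5)]] by blast
  have E_sq: "(norm (E x))\<^sup>2 \<le> K\<^sup>2 * (norm x)\<^sup>2" for x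
    using power_mono[OF K(2), of x 2] by (simp add: power_mult_distrib mult.commute)
  have sum_sq: "(norm (s1 u + s2 v))\<^sup>2 = (norm u)\<^sup>2 + (norm v)\<^sup>2" for u v
    by (simp add: norms[of "s1 u + s2 v"] rules inv)
  have s2_norm: "norm (s2 v) = norm v" for v
    using sum_sq[of 0 v] by (simp add: rules power2_eq_iff_nonneg)
  define a where "a x n = (norm ((t2 ^^ n) x))\<^sup>2" for x n
  have X_bound: "(norm (X n x))\<^sup>2 \<le> K\<^sup>2 * ((norm x)\<^sup>2 - a x n)" for n x
  proof (induction n arbitrary: x)
    case (Suc n)
    have "(norm (X (Suc n) x))\<^sup>2 = (norm (E (t1 x)))\<^sup>2 + (norm (X n (t2 x)))\<^sup>2"
      by (simp add: X_Suc sum_sq)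
    also have "\<dots> \<le> K\<^sup>2 * (norm (t1 x))\<^sup>2 + K\<^sup>2 * ((norm (t2 x))\<^sup>2 - a (t2 x) n)"
      by (intro add_mono E_sq Suc.IH)
    also have "\<dots> = K\<^sup>2 * ((norm x)\<^sup>2 - a x (Suc n))"
      by (simp add: norms[of x] a_def funpow_swap1 algebra_simps)
    finally show ?case .
  qed (simp add: X0 a_def)
  have X_diff: "norm (X (N + m) x - X N x) = norm (X m ((t2 ^^ N) x))" for N m x
  proof (induction N arbitrary: x)
    case (Suc N)
    have "X (Suc N + m) x - X (Suc N) x = s2 (X (N + m) (t2 x) - X N (t2 x))"
      by (simp add: X_Suc rules)
    then show ?case
      by (simp add: s2_norm Suc.IH funpow_swap1)
  qed (simp add: X0)
  have X_cauchy: "convergent (\<lambda>n. X n x)" for x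
  proof (rule Cauchy_convergent)
    have "a x (Suc n) \<le> a x n" for n
      using norms[of "(t2 ^^ n) x"] zero_le_power2[of "norm (t1 ((t2 ^^ n) x))"] by (simp add: a_def)
    then have "decseq (a x)"
      by (intro decseq_SucI)
    moreover have "\<And>n. 0 \<le> a x n"
      by (simp add: a_def)
    ultimately obtain L where L: "a x \<longlonglongrightarrow> L" "\<And>n. L \<le> a x n"
      using decseq_convergent by blast
    show "Cauchy (\<lambda>n. X n x)"
    proof (rule metric_CauchyI)
      fix e :: real
      assume "e > 0"
      then have "\<forall>\<^sub>F n in sequentially. a x n < L + (e / K)\<^sup>2 / 4"
        using K(1) by (intro order_tendstoD[OF L(1)]) simp
      then obtain N where N: "a x N < L + (e / K)\<^sup>2 / 4"
        by (auto simp: eventually_sequentially)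
      have near: "norm (X (N + m) x - X N x) < e / 2" for m
      proof -
        have "a ((t2 ^^ N) x) m = a x (N + m)"
          unfolding a_def add.commute[of N m] funpow_add by simp
        then have "(norm (X (N + m) x - X N x))\<^sup>2 \<le> K\<^sup>2 * (a x N - a x (N + m))"
          using X_bound[of m "(t2 ^^ N) x"] by (simp add: X_diff a_def[of x N])
        also have "\<dots> < K\<^sup>2 * ((e / K)\<^sup>2 / 4)"
          using N L(2)[of "N + m"] K(1) by (intro mult_strict_left_mono) auto
        also have "\<dots> = (e / 2)\<^sup>2"
          using K(1) by (simp add: power_divide)
        finally show ?thesis
          by (rule power2_less_imp_less) (use \<open>e > 0\<close> in simp)
      qed
      have near': "dist (X m x) (X N x) < e / 2" if "m \<ge> N" for m
        using near[of "m - N"] that by (simp add: dist_norm)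
      show "\<exists>M. \<forall>m\<ge>M. \<forall>n\<ge>M. dist (X m x) (X n x) < e"
        by (rule exI[of _ N]) (auto intro: dist_triangle_half_l[OF near' near'])
    qed
  qed
  define P where "P x = lim (\<lambda>n. X n x)" for x
  have lim: "(\<lambda>n. X n x) \<longlonglongrightarrow> P x" for x
    using X_cauchy by (simp add: P_def convergent_LIMSEQ_iff)
  have X_add: "X n (x + y) = X n x + X n y" for n x y
    by (induction n arbitrary: x y) (simp_all add: X0 X_Suc rules)
  have X_scale: "X n (c *\<^sub>C x) = c *\<^sub>C X n x" for n c x
    by (induction n arbitrary: x) (simp_all add: X0 X_Suc rules scaleC_add_right)
  have X_norm: "norm (X n x) \<le> K * norm x" for n x
  proof -
    have "(norm (X n x))\<^sup>2 \<le> (K * norm x)\<^sup>2"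
    proof -
      have "K\<^sup>2 * ((norm x)\<^sup>2 - a x n) \<le> K\<^sup>2 * (norm x)\<^sup>2"
        by (intro mult_left_mono) (simp_all add: a_def)
      then show ?thesis
        using X_bound[of n x] by (simp add: power_mult_distrib)
    qed
    then show ?thesis
      using K(1) by (simp add: power2_le_iff_abs_le)
  qed
  show ?thesis
  proof (rule that)
    show "P \<in> \<B>"
      unfolding bounded_operators_iff
    proof (intro conjI allI exI)
      show "P (x + y) = P x + P y" for x y
        using tendsto_add[OF lim lim, of x y] lim[of "x + y"]
        unfolding X_add[symmetric] by (rule LIMSEQ_unique[rotated])
      show "P (c *\<^sub>C x) = c *\<^sub>C P x" for c x
        using bounded_linear.tendsto[OF bounded_linear_scaleC lim, of c x] lim[of "c *\<^sub>C x"]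
        unfolding X_scale[symmetric] by (rule LIMSEQ_unique[rotated])
      show "norm (P x) \<le> K * norm x" for x
        using X_norm by (intro Lim_norm_ubound[OF _ lim]) auto
    qed
    show "P x = s1 (E (t1 x)) + s2 (P (t2 x))" for x
    proof (rule LIMSEQ_unique)
      show "(\<lambda>n. X (Suc n) x) \<longlonglongrightarrow> P x"
        using lim by (rule LIMSEQ_Suc)
      show "(\<lambda>n. X (Suc n) x) \<longlonglongrightarrow> s1 (E (t1 x)) + s2 (P (t2 x))"
        unfolding X_Suc
        by (intro tendsto_intros bounded_linear.tendsto[OF bounded_operator_rules(5)[OF B(2)] lim])
    qed
  qed
qed

text \<open>The equation \<open>2 y - T y = z\<close> says that \<open>y\<close> is a fixed point of \<open>y \<mapsto> (z + T y) / 2\<close>, which has Lipschitz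
constant \<open>1 / 2\<close>. Thus Banach's fixed point theorem gives the inverse.\<close>

lemma two_minus_contraction_invertible:
  fixes T :: "'h::complex_hilbert_space \<Rightarrow> 'h"
  assumes T: "T \<in> \<B>" and le: "\<And>x. norm (T x) \<le> norm x"
  obtains R where "R \<in> \<B>" "\<And>x. R (x + x - T x) = x" "\<And>x. R x + R x - T (R x) = x"
proof -
  note rules = bounded_operator_rules[OF T]
  have "\<exists>!y. (1/2) *\<^sub>R (z + T y) = y" for z
  proof (rule banach_fix_type[where c = "1/2"])
    show "\<forall>x y. dist ((1/2) *\<^sub>R (z + T x)) ((1/2) *\<^sub>R (z + T y)) \<le> 1/2 * dist x y"
    proof (intro allI)
      fix x y
      have "(1/2) *\<^sub>R (z + T x) - (1/2) *\<^sub>R (z + T y) = (1/2) *\<^sub>R T (x - y)"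
        by (simp add: rules scaleR_right_diff_distrib scaleR_add_right)
      then show "dist ((1/2) *\<^sub>R (z + T x)) ((1/2) *\<^sub>R (z + T y)) \<le> 1/2 * dist x y"
        using le[of "x - y"] by (simp add: dist_norm)
    qed
  qed simp_all
  moreover have "(1/2) *\<^sub>R (z + T y) = y \<longleftrightarrow> y + y - T y = z" for z y
  proof
    assume "(1/2) *\<^sub>R (z + T y) = y"
    then have "2 *\<^sub>R y = 2 *\<^sub>R ((1/2) *\<^sub>R (z + T y))"
      by simp
    then have "y + y = z + T y"
      by (simp add: scaleR_2)
    then show "y + y - T y = z"
      by simp
  next
    assume "y + y - T y = z"
    then have "z + T y = 2 *\<^sub>R y"
      by (auto simp: scaleR_2)
    then show "(1/2) *\<^sub>R (z + T y) = y"
      by simp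
  qed
  ultimately have unique: "\<exists>!y. y + y - T y = z" for z
    by simp
  define R where "R z = (THE y. y + y - T y = z)" for z
  have R: "R z + R z - T (R z) = z" for z
    unfolding R_def using theI'[OF unique] .
  have R_eq: "R z = y" if "y + y - T y = z" for y z
    using unique[of z] R[of z] that by blast
  show ?thesis
  proof (rule that)
    show "R \<in> \<B>"
      unfolding bounded_operators_iff
    proof (intro conjI allI exI)
      show "R (x + y) = R x + R y" for x y
      proof (rule R_eq)
        have "R x + R y + (R x + R y) - T (R x + R y) = (R x + R x - T (R x)) + (R y + R y - T (R y))"
          by (simp add: rules algebra_simps)
        then show "R x + R y + (R x + R y) - T (R x + R y) = x + y"
          by (simp add: R)
      qed
      show "R (c *\<^sub>C x) = c *\<^sub>C R x" for c x
      proof (rule R_eq)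
        have "c *\<^sub>C R x + c *\<^sub>C R x - T (c *\<^sub>C R x) = c *\<^sub>C (R x + R x - T (R x))"
          by (simp add: rules complex_vector.scale_right_diff_distrib scaleC_add_right)
        then show "c *\<^sub>C R x + c *\<^sub>C R x - T (c *\<^sub>C R x) = c *\<^sub>C x"
          by (simp add: R)
      qed
      show "norm (R x) \<le> 1 * norm x" for x
      proof -
        have "R x + R x = x + T (R x)"
          using R[of x] by (simp add: diff_eq_eq)
        moreover have "norm (R x + R x) = 2 * norm (R x)"
          by (simp flip: scaleR_2)
        ultimately have "2 * norm (R x) = norm (x + T (R x))"
          by simp
        also have "\<dots> \<le> norm x + norm (R x)"
          using norm_triangle_ineq[of x "T (R x)"] le[of "R x"] by linarith
        finally show ?thesis
          by simp
      qed
    qed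
  qed (use R R_eq in auto)
qed

lemma operator_ring_is_double:
  assumes "infinite_dimensional TYPE('h::complex_hilbert_space)"
  obtains s1 s2 t1 t2 :: "'h::complex_hilbert_space operator" where
    "t1 * s1 = 1" "t2 * s2 = 1" "t1 * s2 = 0" "t2 * s1 = 0" "s1 * t1 + s2 * t2 = 1"
    "\<And>x. (norm x)\<^sup>2 = (norm (apply_operator t1 x))\<^sup>2 + (norm (apply_operator t2 x))\<^sup>2"
proof -
  obtain s1 s2 t1 t2 :: "'h \<Rightarrow> 'h" where B: "s1 \<in> \<B>" "s2 \<in> \<B>" "t1 \<in> \<B>" "t2 \<in> \<B>"
    and h: "\<And>x. t1 (s1 x) = x" "\<And>x. t2 (s2 x) = x" "\<And>x. t1 (s2 x) = 0" "\<And>x. t2 (s1 x) = 0"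
    "\<And>x. s1 (t1 x) + s2 (t2 x) = x" "\<And>x. (norm x)\<^sup>2 = (norm (t1 x))\<^sup>2 + (norm (t2 x))\<^sup>2"
    by (rule hilbert_space_is_double[OF assms]) blast
  show ?thesis
    by (rule that[of "Operator t1" "Operator s1" "Operator t2" "Operator s2"])
      (auto intro!: operator_eqI simp: apply_simps Operator_inverse B h(1-5) h(6)[symmetric])
qed

text \<open>Both \<open>t1\<close> and \<open>s2\<close> are contractions, so \<open>2 - t1\<close> and \<open>2 - s2\<close> are units.\<close>

lemma every_operator_is_sum_of_twists:
  fixes s1 s2 t1 t2 E :: "'h::complex_hilbert_space operator"
  assumes inv: "t1 * s1 = 1" "t2 * s2 = 1" "t1 * s2 = 0" "t2 * s1 = 0"
    and norms: "\<And>x. (norm x)\<^sup>2 = (norm (apply_operator t1 x))\<^sup>2 + (norm (apply_operator t2 x))\<^sup>2"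
  shows "\<exists>x y h h' k k'. h * h' = 1 \<and> h' * h = 1 \<and> k * k' = 1 \<and> k' * k = 1 \<and>
      E = (x - h * x * h') + (y - k * y * k')"
proof -
  have inv': "apply_operator t1 (apply_operator s1 x) = x" "apply_operator t2 (apply_operator s2 x) = x"
    "apply_operator t1 (apply_operator s2 x) = 0" "apply_operator t2 (apply_operator s1 x) = 0" for x
    unfolding apply_simps(5)[symmetric] inv apply_simps by (rule refl)+
  have "norm (apply_operator t1 x) \<le> norm x" for x
    by (rule power2_le_imp_le) (use norms[of x] in simp_all)
  then obtain R1 where R1: "R1 \<in> \<B>" "\<And>x. R1 (x + x - apply_operator t1 x) = x"
    "\<And>x. R1 x + R1 x - apply_operator t1 (R1 x) = x"
    using two_minus_contraction_invertible[OF apply_operator] by blast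
  have "norm (apply_operator s2 x) \<le> norm x" for x
    by (rule power2_le_imp_le) (simp_all add: norms[of "apply_operator s2 x"] inv')
  then obtain R2 where R2: "R2 \<in> \<B>" "\<And>x. R2 (x + x - apply_operator s2 x) = x"
    "\<And>x. R2 x + R2 x - apply_operator s2 (R2 x) = x"
    using two_minus_contraction_invertible[OF apply_operator] by blast
  obtain P where P: "P \<in> \<B>" "\<And>x. P x = apply_operator s1 (apply_operator E (apply_operator t1 x)) +
      apply_operator s2 (P (apply_operator t2 x))"
    by (rule ampliation_exists[OF apply_operator[of s1] apply_operator[of s2] apply_operator[of t1]
          apply_operator[of t2] apply_operator[of E] inv' norms]) blast
  show ?thesis
  proof (rule twists_from_shifts[OF inv(1,2), where E = E])
    show "(1 + 1 - t1) * Operator R1 = 1" "Operator R1 * (1 + 1 - t1) = 1"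
      "(1 + 1 - s2) * Operator R2 = 1" "Operator R2 * (1 + 1 - s2) = 1"
      by (rule operator_eqI, simp add: apply_simps Operator_inverse R1 R2)+
    show "Operator P = s1 * E * t1 + s2 * Operator P * t2"
      by (rule operator_eqI) (simp add: apply_simps Operator_inverse P(1) P(2)[symmetric])
  qed
qed

section \<open>Cubic polynomials of operators\<close>

lemma cubic_splits:
  fixes p :: "complex poly"
  assumes "degree p = 3"
  obtains k a b c where "p = smult k ([:-a, 1:] * [:-b, 1:] * [:-c, 1:])"
proof -
  have nonzero: "p \<noteq> 0"
    using assms by auto
  obtain A where A: "size A = degree p" "p = smult (lead_coeff p) (\<Prod>x\<in>#A. [:-x, 1:])"
    using alg_closed_imp_factorization[OF nonzero] by (elim exE conjE) (rule that)
  obtain a A' where a: "A = add_mset a A'" "size A' = 2"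
    using size_eq_Suc_imp_eq_union[of A 2] A(1) assms by auto
  obtain b A'' where b: "A' = add_mset b A''" "size A'' = 1"
    using size_eq_Suc_imp_eq_union[of A' 1] a(2) by auto
  obtain c where c: "A'' = {#c#}"
    using b(2) size_1_singleton_mset by blast
  have factors: "(\<Prod>x\<in>#A. [:-x, 1:]) = [:-a, 1:] * [:-b, 1:] * [:-c, 1:]"
    unfolding a(1) b(1) c by (simp only: image_mset_add_mset image_mset_empty prod_mset.add_mset
        prod_mset.empty mult_1_right mult.assoc)
  show ?thesis
    by (rule that) (rule A(2)[unfolded factors])
qed

text \<open>Links evaluation of a polynomial at an operator to the factored form used in the ring part: expanding
the product of the linear factors gives the coefficients of \<open>p\<close> up to the leading one, because scalars
commute with \<open>T\<close>.\<close>

lemma poly_op_cubic_zero: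
  assumes "degree p = 3" and p: "p = smult k ([:-a, 1:] * [:-b, 1:] * [:-c, 1:])"
    and T: "(T - scalar_operator a) * (T - scalar_operator b) * (T - scalar_operator c) = 0"
  shows "poly_op p (apply_operator T) = (\<lambda>x. 0)"
proof
  fix x
  define t where "t = apply_operator T"
  have t: "t (u - v) = t u - t v" "t (d *\<^sub>C u) = d *\<^sub>C t u" for u v d
    unfolding t_def by (rule apply_operator_rules)+
  note scale = complex_vector.scale_right_diff_distrib complex_vector.scale_left_diff_distrib
    scaleC_add_left scaleC_add_right scaleC_scaleC complex_vector.scale_minus_left
  have "0 = apply_operator ((T - scalar_operator a) * (T - scalar_operator b) * (T - scalar_operator c)) x"
    unfolding T apply_simps ..
  also have "\<dots> = t (t (t x)) + (- (a + b + c)) *\<^sub>C t (t x) + (a * b + b * c + a * c) *\<^sub>C t x + (- (a * b * c)) *\<^sub>C x"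
    unfolding apply_simps t_def[symmetric] t by (simp add: scale algebra_simps)
  finally have cubic: "t (t (t x)) + (- (a + b + c)) *\<^sub>C t (t x) + (a * b + b * c + a * c) *\<^sub>C t x + (- (a * b * c)) *\<^sub>C x = 0"
    by simp
  have coeffs: "p = [:k * (- (a * b * c)), k * (a * b + b * c + a * c), k * (- (a + b + c)), k:]"
    unfolding p by (simp add: algebra_simps)
  have "poly_op p t x = (\<Sum>i\<le>3. coeff p i *\<^sub>C (t ^^ i) x)"
    unfolding poly_op_def assms(1) ..
  also have "\<dots> = k *\<^sub>C (t (t (t x)) + (- (a + b + c)) *\<^sub>C t (t x) + (a * b + b * c + a * c) *\<^sub>C t x + (- (a * b * c)) *\<^sub>C x)"
    unfolding coeffs by (simp add: numeral_3_eq_3 scaleC_add_right scaleC_scaleC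
        complex_vector.scale_right_diff_distrib algebra_simps)
  finally show "poly_op p (apply_operator T) x = 0"
    unfolding cubic t_def[symmetric] by simp
qed

theorem proposition3p1:
  fixes B :: "'h::complex_hilbert_space \<Rightarrow> 'h"
    and p1 p2 p3 p4 :: "complex poly"
  assumes "infinite_dimensional TYPE('h)"
    and "degree p1 = 3" and "degree p2 = 3" and "degree p3 = 3" and "degree p4 = 3"
    and "B \<in> \<B>"
  shows "\<exists>B1 \<in> \<B>. \<exists>B2 \<in> \<B>. \<exists>B3 \<in> \<B>. \<exists>B4 \<in> \<B>.
           B = (\<lambda>x. B1 x + B2 x + B3 x + B4 x) \<and>
           poly_op p1 B1 = (\<lambda>x. 0) \<and> poly_op p2 B2 = (\<lambda>x. 0) \<and>
           poly_op p3 B3 = (\<lambda>x. 0) \<and> poly_op p4 B4 = (\<lambda>x. 0)"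
proof -
  obtain s1 s2 t1 t2 :: "'h operator" where
    inv: "t1 * s1 = 1" "t2 * s2 = 1" "t1 * s2 = 0" "t2 * s1 = 0" and sum: "s1 * t1 + s2 * t2 = 1" and
    norms: "\<And>x. (norm x)\<^sup>2 = (norm (apply_operator t1 x))\<^sup>2 + (norm (apply_operator t2 x))\<^sup>2"
    by (rule operator_ring_is_double[OF assms(1)]) blast
  note frame = matrix_frame_from_halves[OF inv sum]
  note twists = every_operator_is_sum_of_twists[OF inv norms]
  obtain k1 a1 b1 c1 where p1: "p1 = smult k1 ([:-a1, 1:] * [:-b1, 1:] * [:-c1, 1:])"
    by (rule cubic_splits[OF assms(2)])
  obtain k2 a2 b2 c2 where p2: "p2 = smult k2 ([:-a2, 1:] * [:-b2, 1:] * [:-c2, 1:])"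
    by (rule cubic_splits[OF assms(3)])
  obtain k3 a3 b3 c3 where p3: "p3 = smult k3 ([:-a3, 1:] * [:-b3, 1:] * [:-c3, 1:])"
    by (rule cubic_splits[OF assms(4)])
  obtain k4 a4 b4 c4 where p4: "p4 = smult k4 ([:-a4, 1:] * [:-b4, 1:] * [:-c4, 1:])"
    by (rule cubic_splits[OF assms(5)])
  let ?s = "scalar_operator :: complex \<Rightarrow> 'h operator"
  obtain B1 B2 B3 B4 :: "'h operator" where sum: "Operator B = B1 + B2 + B3 + B4"
    and zero: "(B1 - ?s a1) * (B1 - ?s b1) * (B1 - ?s c1) = 0" "(B2 - ?s a2) * (B2 - ?s b2) * (B2 - ?s c2) = 0"
      "(B3 - ?s a3) * (B3 - ?s b3) * (B3 - ?s c3) = 0" "(B4 - ?s a4) * (B4 - ?s b4) * (B4 - ?s c4) = 0"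
    by (rule matrix_frame.sum_of_four_cubics[OF frame twists,
          of "?s a1" "?s b1" "?s c1" "?s a2" "?s b2" "?s c2" "?s a3" "?s b3" "?s c3" "?s a4" "?s b4" "?s c4" "Operator B"])
      (intro scalar_operator_central | blast)+
  have "B = apply_operator (B1 + B2 + B3 + B4)"
    unfolding sum[symmetric] by (simp add: Operator_inverse assms(6))
  then have "B = (\<lambda>x. apply_operator B1 x + apply_operator B2 x + apply_operator B3 x + apply_operator B4 x)"
    by (simp add: fun_eq_iff apply_simps)
  with poly_op_cubic_zero[OF assms(2) p1 zero(1)] poly_op_cubic_zero[OF assms(3) p2 zero(2)]
    poly_op_cubic_zero[OF assms(4) p3 zero(3)] poly_op_cubic_zero[OF assms(5) p4 zero(4)]
  show ?thesis
    using apply_operator by blast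
qed

end
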